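(* Let $\Omega_i=\mathbb{R}^{m_i}$, $i=1,2,3$. Suppose that $W^{2d}$ is convex and locally strictly convex at $(u^{1d},u^{2d},u^{3d})$, that Assumption (A) of the context is satisfied, that $J_2$ is Fréchet differentiable at $(u^{1d},u^{2d},u^{3d})$, and that $\nabla_{u^1}J_2(u^{1d},u^{2d},u^{3d})\ne0$. Then there exists an affine leader's function realizing the desired equilibrium, of the form $$\gamma^1(u^2,u^3)=u^{1d}+R_1R_2^{-1}(u^2-u^{2d})+R_1'R_3^{-1}(u^3-u^{3d}),\qquad R_2=I_{m_2},\ R_3=I_{m_3},$$ where the matrices $R_1\in\mathbb{R}^{m_1\times m_2}$ and $R_1'\in\mathbb{R}^{m_1\times m_3}$ belong to the affine spaces $$\mathcal{R}_1=\{R_{11}^0+B_Nt_1\},\qquad \mathcal{R}_1'=\{R_{12}^0+B_Nt_2\},$$ with $t_1,t_2$ free parameters (matrices of appropriate sizes, arbitrary). Here $R_{11}^0$ and $R_{12}^0$ are particular solutions of $$\nabla_{u^1}J_2(u^{1d},u^{2d},u^{3d})^{\top}R_1=-\nabla_{u^2}J_2(u^{1d},u^{2d},u^{3d})^{\top}I_{m_2}$$ and $$\nabla_{u^1}J_2(u^{1d},u^{2d},u^{3d})^{\top}R_1'=-\nabla_{u^3}J_2(u^{1d},u^{2d},u^{3d})^{\top}I_{m_3}$$ respectively, and $B_N$ is a matrix whose columns form a basis of the null space $\{v\in\mathbb{R}^{m_1}:\nabla_{u^1}J_2(u^{1d},u^{2d},u^{3d})^{\top}v=0\}$.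
   Context: Trilevel static game: the leader, the middle level player and the follower choose $u^1\in\Omega_1$, $u^2\in\Omega_2$, $u^3\in\Omega_3$ respectively, where $\Omega_i=\mathbb{R}^{m_i}$, $m_i\ge 1$, and minimize cost functions $J_1,J_2,J_3:\Omega_1\times\Omega_2\times\Omega_3\to\mathbb{R}$ respectively. $J_1$ is assumed to have a unique global minimizer $(u^{1d},u^{2d},u^{3d})$, called the desired equilibrium. Gradients are column vectors. Sublevel set: $W^{2d}=\{(u^1,u^2,u^3): J_2(u^1,u^2,u^3)\le J_2(u^{1d},u^{2d},u^{3d})\}$. Strategy classes: $\Gamma^1$ is the set of affine maps $\gamma^1:\Omega_2\times\Omega_3\to\Omega_1$ with $\gamma^1(u^{2d},u^{3d})=u^{1d}$; $\Gamma^2$ is the set of affine maps $\gamma^2:\Omega_3\to\Omega_2$ with $\gamma^2(u^{3d})=u^{2d}$. Condition (L) on $\gamma^1\in\Gamma^1$: $(u^{2d},u^{3d})$ is the unique minimizer of $(u^2,u^3)\mapsto J_2(\gamma^1(u^2,u^3),u^2,u^3)$ over $\Omega_2\times\Omega_3$. Condition (M) on a pair $\gamma^1\in\Gamma^1,\gamma^2\in\Gamma^2$: $u^{3d}$ is the unique minimizer of $u^3\mapsto J_3(\gamma^1(\gamma^2(u^3),u^3),\gamma^2(u^3),u^3)$ over $\Omega_3$. The map $\gamma^1$ realizes the desired equilibrium if $\gamma^1\in\Gamma^1$, (L) holds, and there is $\gamma^2\in\Gamma^2$ such that (M) holds. Assumption (A): for every $\gamma^1\in\Gamma^1$ satisfying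 (L) there is $\gamma^2\in\Gamma^2$ such that (M) holds. That $t_1,t_2$ are free parameters means that every choice of $t_1\in\mathbb{R}^{(m_1-1)\times m_2}$, $t_2\in\mathbb{R}^{(m_1-1)\times m_3}$ yields such a leader's function (if $m_1=1$ the terms $B_Nt_i$ are absent). A set $W$ is locally strictly convex at a point $x\in W$ if $x$ is a boundary point of $W$ and there is a neighbourhood $U$ of $x$ such that for every $y\in W\cap U$, $y\ne x$, the open segment between $x$ and $y$ lies in the interior of $W$. *)

theory Defs
  imports "HOL-Analysis.Analysis"
begin

definition unique_minimizer :: "('a \<Rightarrow> real) \<Rightarrow> 'a \<Rightarrow> bool" where
  "unique_minimizer f x \<longleftrightarrow>
     is_arg_min f (\<lambda>_. True) x \<and> (\<forall>y. is_arg_min f (\<lambda>_. True) y \<longrightarrow> y = x)"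

definition affine_map :: "('a::real_vector \<Rightarrow> 'b::real_vector) \<Rightarrow> bool" where
  "affine_map f \<longleftrightarrow> (\<exists>L c. linear L \<and> (\<forall>x. f x = L x + c))"

definition sublevel :: "('a \<Rightarrow> real) \<Rightarrow> 'a \<Rightarrow> 'a set" where
  "sublevel J x = {y. J y \<le> J x}"

definition locally_strictly_convex_at :: "'a::real_normed_vector set \<Rightarrow> 'a \<Rightarrow> bool" where
  "locally_strictly_convex_at W x \<longleftrightarrow>
     x \<in> W \<and> x \<in> frontier W \<and>
     (\<exists>U. open U \<and> x \<in> U \<and>
        (\<forall>y \<in> W \<inter> U. y \<noteq> x \<longrightarrow> open_segment x y \<subseteq> interior W))"

text \<open>Meaningful only where the function is differentiable; the gradient is then unique.\<close>

definition gradient :: "('a::real_inner \<Rightarrow> real) \<Rightarrow> 'a \<Rightarrow> 'a" where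
  "gradient f x = (THE D. GDERIV f x :> D)"

definition grad1 :: "('a::real_inner \<times> 'b \<times> 'c \<Rightarrow> real) \<Rightarrow> 'a \<Rightarrow> 'b \<Rightarrow> 'c \<Rightarrow> 'a" where
  "grad1 J u1 u2 u3 = gradient (\<lambda>v. J (v, u2, u3)) u1"

definition grad2 :: "('a \<times> 'b::real_inner \<times> 'c \<Rightarrow> real) \<Rightarrow> 'a \<Rightarrow> 'b \<Rightarrow> 'c \<Rightarrow> 'b" where
  "grad2 J u1 u2 u3 = gradient (\<lambda>v. J (u1, v, u3)) u2"

definition grad3 :: "('a \<times> 'b \<times> 'c::real_inner \<Rightarrow> real) \<Rightarrow> 'a \<Rightarrow> 'b \<Rightarrow> 'c \<Rightarrow> 'c" where
  "grad3 J u1 u2 u3 = gradient (\<lambda>v. J (u1, u2, v)) u3"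

definition leader_strategies ::
    "'a::real_vector \<Rightarrow> 'b::real_vector \<Rightarrow> 'c::real_vector \<Rightarrow> ('b \<times> 'c \<Rightarrow> 'a) set" where
  "leader_strategies u1d u2d u3d = {\<gamma>1. affine_map \<gamma>1 \<and> \<gamma>1 (u2d, u3d) = u1d}"

definition middle_strategies :: "'b::real_vector \<Rightarrow> 'c::real_vector \<Rightarrow> ('c \<Rightarrow> 'b) set" where
  "middle_strategies u2d u3d = {\<gamma>2. affine_map \<gamma>2 \<and> \<gamma>2 u3d = u2d}"

definition cond_L :: "('a \<times> 'b \<times> 'c \<Rightarrow> real) \<Rightarrow> 'b \<Rightarrow> 'c \<Rightarrow> ('b \<times> 'c \<Rightarrow> 'a) \<Rightarrow> bool" where
  "cond_L J2 u2d u3d \<gamma>1 \<longleftrightarrow>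
     unique_minimizer (\<lambda>(u2, u3). J2 (\<gamma>1 (u2, u3), u2, u3)) (u2d, u3d)"

definition cond_M ::
    "('a \<times> 'b \<times> 'c \<Rightarrow> real) \<Rightarrow> 'c \<Rightarrow> ('b \<times> 'c \<Rightarrow> 'a) \<Rightarrow> ('c \<Rightarrow> 'b) \<Rightarrow> bool" where
  "cond_M J3 u3d \<gamma>1 \<gamma>2 \<longleftrightarrow>
     unique_minimizer (\<lambda>u3. J3 (\<gamma>1 (\<gamma>2 u3, u3), \<gamma>2 u3, u3)) u3d"

definition realizes_equilibrium ::
    "('a::real_vector \<times> 'b::real_vector \<times> 'c::real_vector \<Rightarrow> real) \<Rightarrow> ('a \<times> 'b \<times> 'c \<Rightarrow> real) \<Rightarrow>
     'a \<Rightarrow> 'b \<Rightarrow> 'c \<Rightarrow> ('b \<times> 'c \<Rightarrow> 'a) \<Rightarrow> bool" where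
  "realizes_equilibrium J2 J3 u1d u2d u3d \<gamma>1 \<longleftrightarrow>
     \<gamma>1 \<in> leader_strategies u1d u2d u3d \<and> cond_L J2 u2d u3d \<gamma>1 \<and>
     (\<exists>\<gamma>2 \<in> middle_strategies u2d u3d. cond_M J3 u3d \<gamma>1 \<gamma>2)"

definition assumption_A ::
    "('a::real_vector \<times> 'b::real_vector \<times> 'c::real_vector \<Rightarrow> real) \<Rightarrow> ('a \<times> 'b \<times> 'c \<Rightarrow> real) \<Rightarrow>
     'a \<Rightarrow> 'b \<Rightarrow> 'c \<Rightarrow> bool" where
  "assumption_A J2 J3 u1d u2d u3d \<longleftrightarrow>
     (\<forall>\<gamma>1 \<in> leader_strategies u1d u2d u3d. cond_L J2 u2d u3d \<gamma>1 \<longrightarrow>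
        (\<exists>\<gamma>2 \<in> middle_strategies u2d u3d. cond_M J3 u3d \<gamma>1 \<gamma>2))"

text \<open>A matrix with \<open>m\<close> rows and \<open>m - 1\<close> columns is given by the family of its columns, and one
  with \<open>m - 1\<close> rows by the family of its rows, both indexed by the naturals below \<open>m - 1\<close>
  (values at other indices are irrelevant). Index types are nonempty, so this is what allows
  \<open>m = 1\<close>, where the product of two such matrices is zero.\<close>

definition columns_form_basis :: "(nat \<Rightarrow> real^'m) \<Rightarrow> (real^'m) set \<Rightarrow> bool" where
  "columns_form_basis B V \<longleftrightarrow>
     inj_on B {..<CARD('m) - 1} \<and> independent (B ` {..<CARD('m) - 1}) \<and>
     span (B ` {..<CARD('m) - 1}) = V"

definition cols_times_rows :: "(nat \<Rightarrow> real^'m) \<Rightarrow> (nat \<Rightarrow> real^'n) \<Rightarrow> real^'n^'m" where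
  "cols_times_rows B t = (\<chi> i j. \<Sum>k<CARD('m) - 1. B k $ i * t k $ j)"

definition parameter_space :: "real^'n^'m \<Rightarrow> (nat \<Rightarrow> real^'m) \<Rightarrow> (real^'n^'m) set" where
  "parameter_space R0 B = {R0 + cols_times_rows B t | t. True}"

definition leader_map ::
    "real^'m1 \<Rightarrow> real^'m2 \<Rightarrow> real^'m3 \<Rightarrow> real^'m2^'m1 \<Rightarrow> real^'m3^'m1 \<Rightarrow>
     (real^'m2) \<times> (real^'m3) \<Rightarrow> real^'m1" where
  "leader_map u1d u2d u3d R1 R1' = (\<lambda>(u2, u3).
     u1d + (R1 ** matrix_inv (mat 1 :: real^'m2^'m2)) *v (u2 - u2d)
         + (R1' ** matrix_inv (mat 1 :: real^'m3^'m3)) *v (u3 - u3d))"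

definition admissible_data ::
    "((real^'m1) \<times> (real^'m2) \<times> (real^'m3) \<Rightarrow> real) \<Rightarrow> real^'m1 \<Rightarrow> real^'m2 \<Rightarrow> real^'m3 \<Rightarrow>
     real^'m2^'m1 \<Rightarrow> real^'m3^'m1 \<Rightarrow> (nat \<Rightarrow> real^'m1) \<Rightarrow> bool" where
  "admissible_data J2 u1d u2d u3d R11 R12 B \<longleftrightarrow>
     grad1 J2 u1d u2d u3d v* R11 = - (grad2 J2 u1d u2d u3d v* mat 1) \<and>
     grad1 J2 u1d u2d u3d v* R12 = - (grad3 J2 u1d u2d u3d v* mat 1) \<and>
     columns_form_basis B {v. grad1 J2 u1d u2d u3d \<bullet> v = 0}"

end

theory Submission
  imports Defs
begin

text \<open>Every point of the graph of the leader's map differs from the desired equilibrium by a vector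
  on which the derivative of \<open>J\<^sub>2\<close> vanishes. If such a point lay in the sublevel set, local strict
  convexity would put a point of the tangent hyperplane into the interior of the sublevel set, and
  pushing it slightly in a direction of increase would give a segment inside the sublevel set
  along which \<open>J\<^sub>2\<close> has positive derivative at the equilibrium.\<close>

text \<open>Since \<open>gradient\<close> is a definite description, existence and uniqueness are
  both required. Existence is Riesz representation, with the adjoint of the derivative applied to 1
  as representer; uniqueness is inherited from that of the Frechet derivative.\<close>

lemma GDERIV_gradient:
  fixes f :: "'a::euclidean_space \<Rightarrow> real"
  assumes "(f has_derivative f') (at x)"
  shows "GDERIV f x :> gradient f x"
proof -
  have lin: "linear f'"
    using assms by (rule has_derivative_linear)
  define D where "D = adjoint f' 1"
  have "f' h = h \<bullet> D" for h
    using adjoint_works[OF lin, of h 1] by (simp add: D_def)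
  then have "f' = (\<lambda>h. h \<bullet> D)" by auto
  with assms have "GDERIV f x :> D"
    by (simp add: gderiv_def)
  moreover have "E = D" if "GDERIV f x :> E" for E
  proof -
    have "(\<lambda>h. h \<bullet> E) = (\<lambda>h. h \<bullet> D)"
      using has_derivative_unique that \<open>GDERIV f x :> D\<close> unfolding gderiv_def by blast
    then have "h \<bullet> E = h \<bullet> D" for h by (rule fun_cong)
    then show ?thesis
      using vector_eq_ldot by blast
  qed
  ultimately show ?thesis
    unfolding gradient_def by (rule theI2)
qed

text \<open>Each partial gradient comes from freezing two arguments, so the chain rule along a
  coordinate embedding identifies it with the derivative on that factor; linearity reassembles the
  three parts.\<close>

lemma has_derivative_gradients:
  fixes J :: "'a::euclidean_space \<times> 'b::euclidean_space \<times> 'c::euclidean_space \<Rightarrow> real"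
  assumes "J differentiable (at (u1, u2, u3))"
  shows "(J has_derivative (\<lambda>(h1, h2, h3).
            h1 \<bullet> grad1 J u1 u2 u3 + h2 \<bullet> grad2 J u1 u2 u3 + h3 \<bullet> grad3 J u1 u2 u3))
          (at (u1, u2, u3))"
proof -
  obtain D where D: "(J has_derivative D) (at (u1, u2, u3))"
    using assms by (auto simp: differentiable_def)
  then have lin: "linear D"
    by (rule has_derivative_linear)
  have "((\<lambda>v. J (v, u2, u3)) has_derivative (\<lambda>h. D (h, 0, 0))) (at u1)"
    by (rule has_derivative_compose[of "\<lambda>v. (v, u2, u3)" "\<lambda>h. (h, 0, 0)", OF _ D])
      (auto intro!: has_derivative_Pair)
  from has_derivative_unique[OF this GDERIV_gradient[OF this, unfolded gderiv_def]]
  have 1: "D (h, 0, 0) = h \<bullet> grad1 J u1 u2 u3" for h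
    unfolding grad1_def by (rule fun_cong)
  have "((\<lambda>v. J (u1, v, u3)) has_derivative (\<lambda>h. D (0, h, 0))) (at u2)"
    by (rule has_derivative_compose[of "\<lambda>v. (u1, v, u3)" "\<lambda>h. (0, h, 0)", OF _ D])
      (auto intro!: has_derivative_Pair)
  from has_derivative_unique[OF this GDERIV_gradient[OF this, unfolded gderiv_def]]
  have 2: "D (0, h, 0) = h \<bullet> grad2 J u1 u2 u3" for h
    unfolding grad2_def by (rule fun_cong)
  have "((\<lambda>v. J (u1, u2, v)) has_derivative (\<lambda>h. D (0, 0, h))) (at u3)"
    by (rule has_derivative_compose[of "\<lambda>v. (u1, u2, v)" "\<lambda>h. (0, 0, h)", OF _ D])
      (auto intro!: has_derivative_Pair)
  from has_derivative_unique[OF this GDERIV_gradient[OF this, unfolded gderiv_def]]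
  have 3: "D (0, 0, h) = h \<bullet> grad3 J u1 u2 u3" for h
    unfolding grad3_def by (rule fun_cong)
  have "D (h1, h2, h3) = h1 \<bullet> grad1 J u1 u2 u3 + h2 \<bullet> grad2 J u1 u2 u3 + h3 \<bullet> grad3 J u1 u2 u3"
    for h1 h2 h3
    using linear_add[OF lin, of "(h1, 0, 0)" "(0, h2, h3)"]
      linear_add[OF lin, of "(0, h2, 0)" "(0, 0, h3)"] by (simp add: 1 2 3)
  then have "D = (\<lambda>(h1, h2, h3).
      h1 \<bullet> grad1 J u1 u2 u3 + h2 \<bullet> grad2 J u1 u2 u3 + h3 \<bullet> grad3 J u1 u2 u3)"
    by auto
  with D show ?thesis by simp
qed

text \<open>A positive derivative towards \<open>q\<close> would make \<open>J\<close> exceed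
  \<open>J x\<close> just after leaving \<open>x\<close>, yet by convexity the segment from
  \<open>x\<close> to \<open>q\<close> never leaves the sublevel set.\<close>

lemma convex_sublevel_derivative_le:
  fixes J :: "'a::real_normed_vector \<Rightarrow> real"
  assumes conv: "convex (sublevel J x)" and J: "(J has_derivative D) (at x)"
    and q: "q \<in> sublevel J x"
  shows "D (q - x) \<le> 0"
proof (rule ccontr)
  assume "\<not> D (q - x) \<le> 0"
  then have pos: "D (q - x) > 0" by simp
  have "((\<lambda>t. x + t *\<^sub>R (q - x)) has_derivative (\<lambda>t. t *\<^sub>R (q - x))) (at 0)"
    by (auto intro!: derivative_eq_intros)
  then have "((\<lambda>t. J (x + t *\<^sub>R (q - x))) has_derivative (\<lambda>t. D (t *\<^sub>R (q - x)))) (at 0)"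
    by (rule has_derivative_compose) (simp add: J)
  then have "((\<lambda>t. J (x + t *\<^sub>R (q - x))) has_real_derivative D (q - x)) (at 0)"
    by (simp add: has_field_derivative_def linear_scale[OF has_derivative_linear[OF J]]
        mult_commute_abs)
  from DERIV_pos_inc_right[OF this pos] obtain d where d: "d > 0"
    and inc: "\<And>t. 0 < t \<Longrightarrow> t < d \<Longrightarrow> J x < J (x + t *\<^sub>R (q - x))"
    by auto
  \<comment> \<open>Small enough for the strict increase (\<open>t < d\<close>) and for a convex
    combination (\<open>t \<le> 1\<close>).\<close>
  define t where "t = min 1 (d / 2)"
  have t: "0 < t" "t < d" "t \<le> 1" using d by (auto simp: t_def min_def)
  have "x + t *\<^sub>R (q - x) = (1 - t) *\<^sub>R x + t *\<^sub>R q"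
    by (simp add: algebra_simps)
  also have "\<dots> \<in> sublevel J x"
    by (rule convexD[OF conv _ q]) (use t in \<open>auto simp: sublevel_def\<close>)
  finally show False
    using inc[OF t(1,2)] by (simp add: sublevel_def)
qed

lemma less_on_tangent_hyperplane:
  fixes J :: "'a::real_normed_vector \<Rightarrow> real"
  assumes conv: "convex (sublevel J x)" and strict: "locally_strictly_convex_at (sublevel J x) x"
    and J: "(J has_derivative D) (at x)" and g: "D g > 0"
    and y: "D (y - x) = 0" "y \<noteq> x"
  shows "J x < J y"
proof (rule ccontr)
  let ?W = "sublevel J x"
  assume "\<not> J x < J y"
  then have yW: "y \<in> ?W" and xW: "x \<in> ?W" by (auto simp: sublevel_def)
  have lin: "linear D" using J by (rule has_derivative_linear)
  obtain U where U: "open U" "x \<in> U"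
    and seg: "\<And>z. z \<in> ?W \<Longrightarrow> z \<in> U \<Longrightarrow> z \<noteq> x \<Longrightarrow> open_segment x z \<subseteq> interior ?W"
    using strict by (auto simp: locally_strictly_convex_at_def)
  \<comment> \<open>Strict convexity is only local and \<open>y\<close> may lie outside
    \<open>U\<close>, so \<open>y\<close> is first pulled along the segment towards
    \<open>x\<close>, to a point in \<open>U\<close> still different from \<open>x\<close>.\<close>
  have "((\<lambda>s. x + s *\<^sub>R (y - x)) \<longlongrightarrow> x + 0 *\<^sub>R (y - x)) (at_right 0)"
    by (intro tendsto_intros)
  then have "\<forall>\<^sub>F s in at_right 0. x + s *\<^sub>R (y - x) \<in> U"
    using U by (auto dest: topological_tendstoD)
  moreover have "\<forall>\<^sub>F s in at_right 0. s < (1::real)"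
    by (simp add: eventually_at_right[of 0 1] exI[of _ 1])
  moreover have "\<forall>\<^sub>F s in at_right 0. (0::real) < s"
    by (simp add: eventually_at_right_less)
  ultimately have "\<forall>\<^sub>F s in at_right 0. x + s *\<^sub>R (y - x) \<in> U \<and> s < 1 \<and> 0 < s"
    by eventually_elim auto
  then obtain s :: real where s: "x + s *\<^sub>R (y - x) \<in> U" "s < 1" "0 < s"
    using eventually_happens trivial_limit_at_right_real by blast
  define z where "z = x + s *\<^sub>R (y - x)"
  have "z = (1 - s) *\<^sub>R x + s *\<^sub>R y" by (simp add: z_def algebra_simps)
  also have "\<dots> \<in> ?W" by (rule convexD[OF conv xW yW]) (use s in auto)
  finally have "open_segment x z \<subseteq> interior ?W"
    using seg s y by (simp add: z_def)
  \<comment> \<open>The midpoint is interior to the sublevel set and still satisfies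
    \<open>D (p - x) = 0\<close>, being displaced from \<open>x\<close> by a multiple of
    \<open>y - x\<close>.\<close>
  moreover define p where "p = midpoint x z"
  ultimately have p: "p \<in> interior ?W"
    using s y by (auto simp: p_def z_def)
  \<comment> \<open>The interior is open, so a small push along \<open>g\<close> stays inside while
    \<open>D\<close> becomes \<open>e * D g > 0\<close>, against the previous lemma.\<close>
  have "((\<lambda>e. p + e *\<^sub>R g) \<longlongrightarrow> p + 0 *\<^sub>R g) (at_right 0)"
    by (intro tendsto_intros)
  then have "\<forall>\<^sub>F e in at_right 0. p + e *\<^sub>R g \<in> interior ?W"
    using p by (auto dest: topological_tendstoD)
  moreover have "\<forall>\<^sub>F e in at_right 0. (0::real) < e"
    by (simp add: eventually_at_right_less)
  ultimately have "\<forall>\<^sub>F e in at_right 0. p + e *\<^sub>R g \<in> interior ?W \<and> 0 < e"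
    by eventually_elim auto
  then obtain e :: real where e: "p + e *\<^sub>R g \<in> interior ?W" "0 < e"
    using eventually_happens trivial_limit_at_right_real by blast
  then have "D (p + e *\<^sub>R g - x) \<le> 0"
    using convex_sublevel_derivative_le[OF conv J] interior_subset by blast
  moreover have "p + e *\<^sub>R g - x = (s / 2) *\<^sub>R (y - x) + e *\<^sub>R g"
    by (simp add: p_def z_def midpoint_def algebra_simps flip: scaleR_add_left)
  ultimately show False
    using e g y by (simp add: linear_add[OF lin] linear_scale[OF lin] mult_le_0_iff)
qed

lemma unique_minimizerI:
  fixes f :: "'a \<Rightarrow> real"
  assumes "\<And>y. y \<noteq> x \<Longrightarrow> f x < f y"
  shows "unique_minimizer f x"
  using assms unfolding unique_minimizer_def is_arg_min_def by (metis less_asym less_irrefl)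

lemma matrix_inv_mat_1: "matrix_inv (mat 1 :: real^'n^'n) = mat 1"
  unfolding matrix_inv_def by (rule some_equality) auto

lemma leader_map_affine:
  "leader_map u1d u2d u3d R1 R1' (u2, u3) = u1d + R1 *v (u2 - u2d) + R1' *v (u3 - u3d)"
  by (simp add: leader_map_def matrix_inv_mat_1)

lemma leader_map_strategy: "leader_map u1d u2d u3d R1 R1' \<in> leader_strategies u1d u2d u3d"
proof -
  have "linear (\<lambda>(u2, u3). R1 *v u2 + R1' *v u3)"
    by (rule linearI)
      (auto simp: matrix_vector_right_distrib scaleR_matrix_vector_assoc algebra_simps
        matrix_vector_mult_scaleR)
  moreover have "leader_map u1d u2d u3d R1 R1' x =
      (\<lambda>(u2, u3). R1 *v u2 + R1' *v u3) x + (u1d - R1 *v u2d - R1' *v u3d)" for x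
    by (cases x) (simp add: leader_map_affine matrix_vector_mult_diff_distrib)
  ultimately have "affine_map (leader_map u1d u2d u3d R1 R1')"
    unfolding affine_map_def by blast
  then show ?thesis
    by (simp add: leader_strategies_def leader_map_affine)
qed

text \<open>The columns of \<open>B\<close> are orthogonal to \<open>g\<close>, so the added product
  is annihilated from the left: every member of the parameter space solves the same linear equation
  as \<open>R0\<close>.\<close>

lemma vector_matrix_mult_parameter_space:
  fixes g :: "real^'m" and R0 :: "real^'n^'m"
  assumes B: "columns_form_basis B {v. g \<bullet> v = 0}" and R: "R \<in> parameter_space R0 B"
  shows "g v* R = g v* R0"
proof -
  obtain t where t: "R = R0 + cols_times_rows B t"
    using R by (auto simp: parameter_space_def)
  have orth: "(\<Sum>i\<in>UNIV. g $ i * B k $ i) = 0" if "k < CARD('m) - 1" for k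
  proof -
    have "B k \<in> span (B ` {..<CARD('m) - 1})"
      using that by (intro span_base imageI) simp
    then have "g \<bullet> B k = 0"
      using B by (simp add: columns_form_basis_def)
    then show ?thesis by (simp add: inner_vec_def)
  qed
  have "(\<Sum>i\<in>UNIV. g $ i * cols_times_rows B t $ i $ j) = 0" for j
  proof -
    have "(\<Sum>i\<in>UNIV. g $ i * cols_times_rows B t $ i $ j)
        = (\<Sum>k<CARD('m) - 1. (\<Sum>i\<in>UNIV. g $ i * B k $ i) * t k $ j)"
      by (simp add: cols_times_rows_def sum_distrib_left sum_distrib_right mult.assoc)
        (rule sum.swap)
    also have "\<dots> = 0"
      by (rule sum.neutral) (simp add: orth)
    finally show ?thesis .
  qed
  then show ?thesis
    by (simp add: t vector_matrix_mult_def vec_eq_iff sum.distrib distrib_left)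
qed

lemma exists_particular_solution:
  fixes g :: "real^'m" and a :: "real^'n"
  assumes "g \<noteq> 0"
  shows "\<exists>R. g v* R = a"
proof
  have "(\<Sum>i\<in>UNIV. g $ i * g $ i) = g \<bullet> g"
    by (simp add: inner_vec_def)
  \<comment> \<open>The witness is the rank-one matrix with entries \<open>g $ i * a $ j\<close>,
    normalized by the squared norm of \<open>g\<close>.\<close>
  then show "g v* (\<chi> i j. g $ i * a $ j / (g \<bullet> g)) = a"
    using assms
    by (simp add: vector_matrix_mult_def vec_eq_iff mult.assoc[symmetric]
        flip: sum_distrib_right sum_divide_distrib)
qed

text \<open>The hyperplane orthogonal to \<open>g\<close> has dimension one less than the space, so
  a basis of it can be enumerated by exactly the indices required; in dimension one the enumeration
  is empty.\<close>

lemma exists_columns_form_basis: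
  fixes g :: "real^'m"
  assumes "g \<noteq> 0"
  shows "\<exists>B. columns_form_basis B {v. g \<bullet> v = 0}"
proof -
  let ?V = "{v. g \<bullet> v = 0}"
  obtain S where S: "S \<subseteq> ?V" "independent S" "?V \<subseteq> span S" "card S = dim ?V"
    using basis_exists by blast
  have "card S = CARD('m) - 1"
    using S(4) dim_hyperplane[OF assms] by simp
  moreover have "finite S"
    using S(2) independent_imp_finite by blast
  ultimately obtain B where B: "bij_betw B {..<CARD('m) - 1} S"
    using ex_bij_betw_nat_finite[of S] by (auto simp: lessThan_atLeast0)
  moreover have "span S = ?V"
    by (rule subset_antisym[OF span_minimal[OF S(1) subspace_hyperplane] S(3)])
  ultimately have "columns_form_basis B ?V"
    using S(2) by (simp add: columns_form_basis_def bij_betw_def)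
  then show ?thesis by blast
qed


theorem theorem4p3:
  fixes J1 J2 J3 :: "(real^'m1) \<times> (real^'m2) \<times> (real^'m3) \<Rightarrow> real"
    and u1d :: "real^'m1" and u2d :: "real^'m2" and u3d :: "real^'m3"
  assumes "unique_minimizer J1 (u1d, u2d, u3d)"
    and "convex (sublevel J2 (u1d, u2d, u3d))"
    and "locally_strictly_convex_at (sublevel J2 (u1d, u2d, u3d)) (u1d, u2d, u3d)"
    and "assumption_A J2 J3 u1d u2d u3d"
    and "J2 differentiable (at (u1d, u2d, u3d))"
    and "grad1 J2 u1d u2d u3d \<noteq> 0"
  shows "(\<exists>R11 R12 B. admissible_data J2 u1d u2d u3d R11 R12 B \<and>
            (\<exists>R1 \<in> parameter_space R11 B. \<exists>R1' \<in> parameter_space R12 B.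
               realizes_equilibrium J2 J3 u1d u2d u3d (leader_map u1d u2d u3d R1 R1'))) \<and>
         (\<forall>R11 R12 B. admissible_data J2 u1d u2d u3d R11 R12 B \<longrightarrow>
            (\<forall>R1 \<in> parameter_space R11 B. \<forall>R1' \<in> parameter_space R12 B.
               realizes_equilibrium J2 J3 u1d u2d u3d (leader_map u1d u2d u3d R1 R1')))"
proof -
  let ?x = "(u1d, u2d, u3d)"
  let ?g1 = "grad1 J2 u1d u2d u3d" and ?g2 = "grad2 J2 u1d u2d u3d" and ?g3 = "grad3 J2 u1d u2d u3d"
  define D where "D = (\<lambda>(h1, h2, h3). h1 \<bullet> ?g1 + h2 \<bullet> ?g2 + h3 \<bullet> ?g3)"
  have J2: "(J2 has_derivative D) (at ?x)"
    unfolding D_def using assms(5) by (rule has_derivative_gradients)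
  have increase: "D (?g1, 0, 0) > 0"
    using assms(6) by (simp add: D_def)
  \<comment> \<open>The universal half comes first; the existential half then only needs admissible
    data to exist.\<close>
  have realizes: "realizes_equilibrium J2 J3 u1d u2d u3d (leader_map u1d u2d u3d R1 R1')"
    if adm: "admissible_data J2 u1d u2d u3d R11 R12 B"
      and R: "R1 \<in> parameter_space R11 B" "R1' \<in> parameter_space R12 B" for R11 R12 B R1 R1'
  proof -
    let ?\<gamma> = "leader_map u1d u2d u3d R1 R1'"
    have basis: "columns_form_basis B {v. ?g1 \<bullet> v = 0}"
      using adm by (simp add: admissible_data_def)
    have R1: "?g1 v* R1 = - ?g2"
      using adm vector_matrix_mult_parameter_space[OF basis R(1)]
      by (simp only: admissible_data_def vector_matrix_mul_rid)
    have R1': "?g1 v* R1' = - ?g3"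
      using adm vector_matrix_mult_parameter_space[OF basis R(2)]
      by (simp only: admissible_data_def vector_matrix_mul_rid)
    have less: "J2 ?x < J2 (?\<gamma> (u2, u3), u2, u3)" if "(u2, u3) \<noteq> (u2d, u3d)" for u2 u3
    proof (rule less_on_tangent_hyperplane[OF assms(2,3) J2 increase])
      \<comment> \<open>The equations for \<open>R1\<close> and \<open>R1'\<close> say exactly that
        the leader's response cancels the first-order effect of the other two players on
        \<open>J2\<close>, so the graph is tangent to the level set.\<close>
      have "(R1 *v a) \<bullet> ?g1 = - (a \<bullet> ?g2)" for a
        using dot_lmul_matrix[of ?g1 R1 a] by (simp add: R1 inner_commute)
      moreover have "(R1' *v a) \<bullet> ?g1 = - (a \<bullet> ?g3)" for a
        using dot_lmul_matrix[of ?g1 R1' a] by (simp add: R1' inner_commute)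
      ultimately show "D ((?\<gamma> (u2, u3), u2, u3) - ?x) = 0"
        by (simp add: D_def leader_map_affine inner_add_left)
    qed (use that in auto)
    have "?\<gamma> (u2d, u3d) = u1d"
      by (simp add: leader_map_affine)
    with less have "(\<lambda>(u2, u3). J2 (?\<gamma> (u2, u3), u2, u3)) (u2d, u3d)
        < (\<lambda>(u2, u3). J2 (?\<gamma> (u2, u3), u2, u3)) y" if "y \<noteq> (u2d, u3d)" for y
      using that by (cases y) simp
    then have "cond_L J2 u2d u3d ?\<gamma>"
      unfolding cond_L_def by (rule unique_minimizerI)
    then show ?thesis
      \<comment> \<open>With (L) established, Assumption (A) supplies the middle player's
        strategy.\<close>
      using assms(4) leader_map_strategy[of u1d u2d u3d R1 R1']
      by (auto simp: realizes_equilibrium_def assumption_A_def)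
  qed
  obtain R11 where "?g1 v* R11 = - (?g2 v* mat 1)"
    using exists_particular_solution[OF assms(6)] by blast
  moreover obtain R12 where "?g1 v* R12 = - (?g3 v* mat 1)"
    using exists_particular_solution[OF assms(6)] by blast
  moreover obtain B where "columns_form_basis B {v. ?g1 \<bullet> v = 0}"
    using exists_columns_form_basis[OF assms(6)] by blast
  ultimately have "admissible_data J2 u1d u2d u3d R11 R12 B"
    by (simp add: admissible_data_def)
  moreover have "parameter_space R11 B \<noteq> {}" "parameter_space R12 B \<noteq> {}"
    by (auto simp: parameter_space_def)
  ultimately show ?thesis
    using realizes by blast
qed

end
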